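(* Let $X$ and $Y$ be normed spaces over $K$ ($K=\mathbb{R}$ or $\mathbb{C}$). For an arbitrary map $F:X\to Y$ put $$p(F)=\max\left(\sup_{x\neq0,\,x\in X}\frac{\|F(x)\|_Y}{\|x\|_X},\ \|F(0)\|_Y\right)\in[0,\infty],$$ and let $B(X,Y)$ be the set of all maps $F:X\to Y$ with $p(F)<\infty$. Then $p$ is a norm on $B(X,Y)$ and $[B(X,Y),p]$ is a normed space.
   Context: Maps $X\to Y$ are arbitrary (not necessarily linear or continuous). Addition and scalar multiplication of maps are pointwise, and the zero element is the map identically equal to $0\in Y$. Normed spaces are assumed nontrivial (not equal to $\{0\}$). *)

theory Defs
  imports Complex_Main "HOL-Library.Function_Algebras" "HOL-Library.Extended_Nonnegative_Real"
begin

text \<open>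
  The library has a class of real normed spaces but none of complex ones, and the space of maps
  below is a subset of a function type with a norm that is finite only on that subset. Normed spaces
  are therefore given by explicit operations on a linear subspace \<open>V\<close> of an ambient vector space.
  The scalar type is meant to be \<^typ>\<open>real\<close> or \<^typ>\<open>complex\<close>, where \<^const>\<open>norm\<close> is the absolute value.
\<close>

definition norm_on :: "'v::ab_group_add set \<Rightarrow> ('k::real_normed_field \<Rightarrow> 'v \<Rightarrow> 'v) \<Rightarrow> ('v \<Rightarrow> real) \<Rightarrow> bool"
  where "norm_on V scale N \<longleftrightarrow>
    (\<forall>v\<in>V. 0 \<le> N v) \<and>
    (\<forall>v\<in>V. N v = 0 \<longleftrightarrow> v = 0) \<and>
    (\<forall>c. \<forall>v\<in>V. N (scale c v) = norm c * N v) \<and>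
    (\<forall>v\<in>V. \<forall>w\<in>V. N (v + w) \<le> N v + N w)"

text \<open>Normed spaces are nontrivial by convention.\<close>

definition normed_space :: "'v::ab_group_add set \<Rightarrow> ('k::real_normed_field \<Rightarrow> 'v \<Rightarrow> 'v) \<Rightarrow> ('v \<Rightarrow> real) \<Rightarrow> bool"
  where "normed_space V scale N \<longleftrightarrow>
    vector_space scale \<and> module.subspace scale V \<and> V \<noteq> {0} \<and> norm_on V scale N"

text \<open>
  Addition and zero of maps are the pointwise ones of \<^theory>\<open>HOL-Library.Function_Algebras\<close>.
\<close>

definition scale_map :: "('k \<Rightarrow> 'y \<Rightarrow> 'y) \<Rightarrow> 'k \<Rightarrow> ('x \<Rightarrow> 'y) \<Rightarrow> 'x \<Rightarrow> 'y"
  where "scale_map scale c F = (\<lambda>x. scale c (F x))"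

definition p :: "('x::zero \<Rightarrow> real) \<Rightarrow> ('y \<Rightarrow> real) \<Rightarrow> ('x \<Rightarrow> 'y) \<Rightarrow> ennreal"
  where "p NX NY F =
    max (SUP x\<in>{x. x \<noteq> 0}. ennreal (NY (F x) / NX x)) (ennreal (NY (F 0)))"

definition B :: "('x::zero \<Rightarrow> real) \<Rightarrow> ('y \<Rightarrow> real) \<Rightarrow> ('x \<Rightarrow> 'y) set"
  where "B NX NY = {F. p NX NY F < \<infinity>}"

text \<open>
  Used only on \<^term>\<open>B NX NY\<close>, where \<^const>\<open>p\<close> is finite and \<^const>\<open>enn2real\<close> loses nothing.
\<close>

definition p_real :: "('x::zero \<Rightarrow> real) \<Rightarrow> ('y \<Rightarrow> real) \<Rightarrow> ('x \<Rightarrow> 'y) \<Rightarrow> real"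
  where "p_real NX NY F = enn2real (p NX NY F)"

end

theory Submission
  imports Defs
begin

text \<open>
  With the weight \<open>w 0 = 1\<close> and \<open>w x = \<parallel>x\<parallel>\<close> for \<open>x \<noteq> 0\<close>, the functional is the weighted supremum norm
  \<open>p F = sup \<parallel>F x\<parallel> / w x\<close> over all \<open>x\<close>, so that \<open>p F \<le> C\<close> means \<open>\<parallel>F x\<parallel> \<le> C * w x\<close> everywhere.
  The norm axioms then follow pointwise from those of \<open>Y\<close>. As \<open>w\<close> is positive, a map supported at
  \<open>0\<close> shows that the space of maps is nontrivial.
\<close>

definition weight :: "('x::zero \<Rightarrow> real) \<Rightarrow> 'x \<Rightarrow> real"
  where "weight NX x = (if x = 0 then 1 else NX x)"

lemma vector_space_scale_map:
  assumes "vector_space scale"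
  shows "vector_space (scale_map scale)"
proof -
  interpret vector_space scale by fact
  show ?thesis
    by unfold_locales
      (simp_all add: scale_map_def fun_eq_iff scale_right_distrib scale_left_distrib)
qed

text \<open>The scalar type \<open>'k\<close> stays generic, so that the real and the complex case
  are two instances of one argument. Positivity of \<open>NX\<close> off \<open>0\<close> is what
  makes the weight positive.\<close>

locale map_space =
  fixes NX :: "'x::zero \<Rightarrow> real"
    and sY :: "'k::real_normed_field \<Rightarrow> 'y::ab_group_add \<Rightarrow> 'y"
    and NY :: "'y \<Rightarrow> real"
  assumes NX_pos: "x \<noteq> 0 \<Longrightarrow> 0 < NX x"
    and normed_space_Y: "normed_space UNIV sY NY"
begin

sublocale Y: vector_space sY
  using normed_space_Y by (simp add: normed_space_def)

sublocale maps: vector_space "scale_map sY"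
  by (rule vector_space_scale_map) unfold_locales

lemma NY_nonneg: "0 \<le> NY v"
  and NY_eq_0_iff: "NY v = 0 \<longleftrightarrow> v = 0"
  and NY_scale: "NY (sY c v) = norm c * NY v"
  and NY_add_le: "NY (v + w) \<le> NY v + NY w"
  using normed_space_Y by (auto simp: normed_space_def norm_on_def)

lemma weight_pos: "0 < weight NX x"
  using NX_pos by (simp add: weight_def)

text \<open>A supremum is at most \<open>C\<close> iff every term is, and denominators clear because
  \<open>NX\<close> is positive off \<open>0\<close>. The condition \<open>0 \<le> C\<close>
  matters: \<open>ennreal\<close> sends negative reals to \<open>0\<close>.\<close>

lemma p_le_iff:
  assumes "0 \<le> C"
  shows "p NX NY F \<le> ennreal C \<longleftrightarrow> (\<forall>x. NY (F x) \<le> C * weight NX x)"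
proof -
  have "NY (F x) \<le> C * weight NX x \<longleftrightarrow>
      (if x = 0 then NY (F 0) \<le> C else NY (F x) / NX x \<le> C)" for x
    using NX_pos[of x] by (simp add: weight_def pos_divide_le_eq)
  then show ?thesis
    using assms by (auto simp: p_def SUP_le_iff ennreal_le_iff)
qed

text \<open>Lets a single pointwise estimate yield both closure of \<open>B\<close> under an
  operation and the matching norm inequality.\<close>

lemma
  assumes "0 \<le> C" and "\<And>x. NY (F x) \<le> C * weight NX x"
  shows in_BI: "F \<in> B NX NY"
    and p_real_le: "p_real NX NY F \<le> C"
proof -
  have "p NX NY F \<le> ennreal C"
    using assms by (simp add: p_le_iff)
  then show "F \<in> B NX NY" "p_real NX NY F \<le> C"
    using assms(1) ennreal_less_top[of C]
    by (auto simp: B_def p_real_def intro: le_less_trans enn2real_leI)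
qed

lemma p_real_nonneg: "0 \<le> p_real NX NY F"
  by (simp add: p_real_def)

text \<open>On \<open>B\<close> the value of \<open>p\<close> is finite, so \<open>p_real\<close> is
  itself an admissible constant \<open>C\<close> in \<open>p_le_iff\<close>.\<close>

lemma NY_le_p_real:
  assumes "F \<in> B NX NY"
  shows "NY (F x) \<le> p_real NX NY F * weight NX x"
proof -
  have "p NX NY F = ennreal (p_real NX NY F)"
    using assms by (simp add: B_def p_real_def)
  then show ?thesis
    using p_le_iff[OF p_real_nonneg, of F F] by simp
qed

lemma
  shows zero_in_B: "0 \<in> B NX NY"
    and p_real_zero: "p_real NX NY 0 = 0"
proof -
  have "NY ((0 :: 'x \<Rightarrow> 'y) x) \<le> 0 * weight NX x" for x
    using NY_eq_0_iff[of 0] by simp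
  from in_BI[of 0 0, OF _ this] p_real_le[of 0 0, OF _ this] show "0 \<in> B NX NY" "p_real NX NY 0 = 0"
    using p_real_nonneg[of 0] by auto
qed

lemma p_real_eq_0_iff:
  assumes "F \<in> B NX NY"
  shows "p_real NX NY F = 0 \<longleftrightarrow> F = 0"
proof
  assume "p_real NX NY F = 0"
  \<comment> \<open>The pointwise bound has constant \<open>0\<close> here, and \<open>NY\<close> is
    nonnegative.\<close>
  then have "NY (F x) = 0" for x
    using NY_le_p_real[OF assms, of x] NY_nonneg[of "F x"] by simp
  then show "F = 0"
    by (simp add: NY_eq_0_iff fun_eq_iff)
qed (simp add: p_real_zero)

lemma
  assumes "F \<in> B NX NY" and "G \<in> B NX NY"
  shows add_in_B: "F + G \<in> B NX NY"
    and p_real_add_le: "p_real NX NY (F + G) \<le> p_real NX NY F + p_real NX NY G"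
proof -
  have "NY ((F + G) x) \<le> (p_real NX NY F + p_real NX NY G) * weight NX x" for x
    using NY_add_le[of "F x" "G x"] NY_le_p_real[OF assms(1), of x] NY_le_p_real[OF assms(2), of x]
    by (simp add: distrib_right)
  from in_BI[of _ "F + G", OF _ this] p_real_le[of _ "F + G", OF _ this]
  show "F + G \<in> B NX NY" "p_real NX NY (F + G) \<le> p_real NX NY F + p_real NX NY G"
    by (simp_all add: p_real_nonneg)
qed

lemma
  assumes "F \<in> B NX NY"
  shows scale_in_B: "scale_map sY c F \<in> B NX NY"
    and p_real_scale_le: "p_real NX NY (scale_map sY c F) \<le> norm c * p_real NX NY F"
proof -
  have "NY (scale_map sY c F x) \<le> (norm c * p_real NX NY F) * weight NX x" for x
    using mult_left_mono[OF NY_le_p_real[OF assms, of x] norm_ge_zero[of c]]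
    by (simp add: scale_map_def NY_scale mult.assoc)
  from in_BI[OF _ this] p_real_le[OF _ this]
  show "scale_map sY c F \<in> B NX NY"
    "p_real NX NY (scale_map sY c F) \<le> norm c * p_real NX NY F"
    by (simp_all add: p_real_nonneg)
qed

lemma p_real_scale:
  assumes "F \<in> B NX NY"
  shows "p_real NX NY (scale_map sY c F) = norm c * p_real NX NY F"
proof (cases "c = 0")
  case True
  then show ?thesis
    by (simp add: p_real_zero)
next
  case False
  \<comment> \<open>The reverse inequality comes from undoing the scaling:
    \<open>p_real_scale_le\<close> is applied with \<open>inverse c\<close> to
    \<open>scale_map sY c F\<close>.\<close>
  have "p_real NX NY F = p_real NX NY (scale_map sY (inverse c) (scale_map sY c F))"
    using False by simp
  also have "\<dots> \<le> norm (inverse c) * p_real NX NY (scale_map sY c F)"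
    by (intro p_real_scale_le scale_in_B assms)
  finally have "norm c * p_real NX NY F \<le> p_real NX NY (scale_map sY c F)"
    using False by (simp add: norm_inverse norm_divide field_simps)
  with p_real_scale_le[OF assms, of c] show ?thesis
    by simp
qed

lemma norm_on_B: "norm_on (B NX NY) (scale_map sY) (p_real NX NY)"
  by (simp add: norm_on_def p_real_nonneg p_real_eq_0_iff p_real_scale p_real_add_le)

lemma B_nontrivial: "B NX NY \<noteq> {0}"
proof -
  obtain y :: 'y where "y \<noteq> 0"
    using normed_space_Y by (auto simp: normed_space_def)
  define F where "F = (\<lambda>x::'x. if x = 0 then y else 0)"
  \<comment> \<open>Equality holds at \<open>0\<close>, where the weight is \<open>1\<close>;
    elsewhere the left side is \<open>0\<close>.\<close>
  have "NY (F x) \<le> NY y * weight NX x" for x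
  proof (cases "x = 0")
    case True
    then show ?thesis
      by (simp add: F_def weight_def)
  next
    case False
    then show ?thesis
      using NY_eq_0_iff[of 0] NY_nonneg[of y] weight_pos[of x] by (simp add: F_def)
  qed
  then have "F \<in> B NX NY"
    using in_BI NY_nonneg by blast
  moreover have "F \<noteq> 0"
    using \<open>y \<noteq> 0\<close> by (auto simp: F_def fun_eq_iff)
  ultimately show ?thesis
    by blast
qed

lemma normed_space_B: "normed_space (B NX NY) (scale_map sY) (p_real NX NY)"
  unfolding normed_space_def
  by (intro conjI maps.subspaceI maps.vector_space_axioms zero_in_B add_in_B scale_in_B
      B_nontrivial norm_on_B)

end

lemma map_space_if_normed_spaces:
  assumes "normed_space UNIV sX NX" and "normed_space UNIV sY NY"
  shows "map_space NX sY NY"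
proof
  show "0 < NX x" if "x \<noteq> 0" for x
    using assms(1) that by (auto simp: normed_space_def norm_on_def less_le)
qed fact

theorem theorem2p2:
  "(\<forall>(sX :: real \<Rightarrow> 'x::ab_group_add \<Rightarrow> 'x) NX (sY :: real \<Rightarrow> 'y::ab_group_add \<Rightarrow> 'y) NY.
      normed_space UNIV sX NX \<longrightarrow> normed_space UNIV sY NY \<longrightarrow>
        norm_on (B NX NY) (scale_map sY) (p_real NX NY) \<and>
        normed_space (B NX NY) (scale_map sY) (p_real NX NY)) \<and>
   (\<forall>(sX :: complex \<Rightarrow> 'x \<Rightarrow> 'x) NX (sY :: complex \<Rightarrow> 'y \<Rightarrow> 'y) NY.
      normed_space UNIV sX NX \<longrightarrow> normed_space UNIV sY NY \<longrightarrow>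
        norm_on (B NX NY) (scale_map sY) (p_real NX NY) \<and>
        normed_space (B NX NY) (scale_map sY) (p_real NX NY))"
  by (blast intro: map_space.norm_on_B map_space.normed_space_B map_space_if_normed_spaces)

end
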